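(* Let $s(z)$ be a (scalar) rational inner function of degree $n>1$ (so $|s_0|<1$, where $s_0=s(0)$), and let $$\omega(z)=\frac1z\cdot\frac{s(z)-s_0}{1-s(z)\overline{s_0}}$$ be the Schur transform of $s(z)$. Let $$U=\begin{bmatrix}s_0&B_0\\ C_0&D_0\end{bmatrix},\quad B_0\in\mathfrak{M}_{1\times n},\ C_0\in\mathfrak{M}_{n\times1},\ D_0\in\mathfrak{M}_{n\times n},$$ be a unitary matrix which yields a minimal system representation $$s(z)=s_0+zB_0(I-zD_0)^{-1}C_0,$$ and whose row $B_0$ has the special form $B_0=[\,b\ \ 0_{1\times(n-1)}\,]$ with $b>0$. Decompose $$C_0=\begin{bmatrix}c_1\\ c_2\end{bmatrix},\qquad D_0=\begin{bmatrix}d_{11}&d_{12}\\ d_{21}&d_{22}\end{bmatrix},$$ with $c_1,d_{11}\in\mathfrak{M}_{1\times1}$, $c_2,d_{21}\in\mathfrak{M}_{(n-1)\times1}$, $d_{12}\in\mathfrak{M}_{1\times(n-1)}$, $d_{22}\in\mathfrak{M}_{(n-1)\times(n-1)}$. Define $$\begin{bmatrix}\alpha&\beta\\ \gamma&\delta\end{bmatrix}=\begin{bmatrix}(1-|s_0|^2)^{-1/2}c_1&d_{12}\\ (1-|s_0|^2)^{-1/2}c_2&d_{22}\end{bmatrix}.$$ Then this $n\times n$ matrix is unitary, the function $\omega(z)$ admits the system representation $$\omega(z)=\alpha+z\beta(I-z\delta)^{-1}\gamma,$$ and the unitary colligation associated with the matrix $\begin{bmatrix}\alpha&\beta\\ \gamma&\delta\end{bmatrix}$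 is minimal.
   Context: $\mathfrak{M}_{p\times q}$ is the set of complex $p\times q$ matrices. A scalar rational inner function is a rational function, holomorphic in $\{|z|<1\}$, of modulus $\le1$ there and of modulus $1$ on $\{|z|=1\}$; its degree is the maximum of the degrees of numerator and denominator in lowest terms. For a unitary matrix $W=\begin{bmatrix}a&b\\ c&d\end{bmatrix}$ of size $(m+1)\times(m+1)$ with $a$ of size $1\times1$ and $d$ of size $m\times m$, the associated unitary colligation (with outer space $\mathbb{C}$ and state space $\mathbb{C}^m$) is minimal if both matrices $[c\ \ dc\ \cdots\ d^{m-1}c]$ and $[b^*\ \ d^*b^*\ \cdots\ (d^* )^{m-1}b^*]$ have rank $m$. The system representation $s(z)=s_0+zB_0(I-zD_0)^{-1}C_0$ is minimal if the colligation associated with $U$ is minimal. *)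

theory Defs
  imports
    "HOL-Complex_Analysis.Complex_Analysis"
    "Jordan_Normal_Form.Gauss_Jordan_Elimination"
    "Jordan_Normal_Form.Schur_Decomposition"
    "Jordan_Normal_Form.DL_Rank"
begin

text \<open>
  A rational function is a total function on the complex plane given by a quotient of coprime
  polynomials. Because division by zero yields zero, it takes the value 0 at its poles, which is
  the convention of \<^const>\<open>remove_sings\<close> as well. The degree is a relation, as the
  lowest-terms representation is unique only up to a nonzero constant.
\<close>

definition rational_of_degree :: "(complex \<Rightarrow> complex) \<Rightarrow> nat \<Rightarrow> bool" where
  "rational_of_degree f n \<longleftrightarrow>
     (\<exists>p q. q \<noteq> 0 \<and> coprime p q \<and> (\<forall>z. f z = poly p z / poly q z) \<and> max (degree p) (degree q) = n)"

definition rational_inner :: "(complex \<Rightarrow> complex) \<Rightarrow> bool" where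
  "rational_inner f \<longleftrightarrow>
     (\<exists>n. rational_of_degree f n) \<and>
     f holomorphic_on {z. cmod z < 1} \<and>
     (\<forall>z. cmod z < 1 \<longrightarrow> cmod (f z) \<le> 1) \<and>
     (\<forall>z. cmod z = 1 \<longrightarrow> cmod (f z) = 1)"

text \<open>
  The defining formula is singular at 0, and its pointwise value is also wrong at poles of
  \<open>s\<close>. \<^const>\<open>remove_sings\<close> replaces each value by the limit where a finite limit exists, and by
  0 at the poles, so that the result is again a rational function in the above sense.
\<close>

definition schur_transform :: "(complex \<Rightarrow> complex) \<Rightarrow> complex \<Rightarrow> complex" where
  "schur_transform s = remove_sings (\<lambda>z. 1 / z * ((s z - s 0) / (1 - s z * cnj (s 0))))"

definition unitary_mat :: "complex mat \<Rightarrow> bool" where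
  "unitary_mat W \<longleftrightarrow>
     square_mat W \<and> inverts_mat (mat_adjoint W) W \<and> inverts_mat W (mat_adjoint W)"

text \<open>
  In \<open>krylov_mat m d c\<close> column \<open>j\<close> is \<open>d\<^sup>j c\<close>, for an \<open>m \<times> m\<close> matrix \<open>d\<close> and an
  \<open>m \<times> 1\<close> matrix \<open>c\<close>.
\<close>

definition krylov_mat :: "nat \<Rightarrow> complex mat \<Rightarrow> complex mat \<Rightarrow> complex mat" where
  "krylov_mat m d c = Matrix.mat m m (\<lambda>(i, j). (d ^\<^sub>m j * c) $$ (i, 0))"

definition minimal_colligation :: "complex mat \<Rightarrow> bool" where
  "minimal_colligation W \<longleftrightarrow>
     (case split_block W 1 1 of (a, b, c, d) \<Rightarrow>
        let m = dim_row d in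
          vec_space.rank m (krylov_mat m d c) = m \<and>
          vec_space.rank m (krylov_mat m (mat_adjoint d) (mat_adjoint b)) = m)"

text \<open>
  The identity \<open>f(z) = a + z b (I - z d)\<^sup>-\<^sup>1 c\<close> is one between rational functions, hence required
  wherever \<open>I - z d\<close> is invertible: everywhere except at the finitely many zeros of \<open>det (I - z d)\<close>,
  which are outside the open unit disc when \<open>W\<close> is unitary.
\<close>

definition system_representation :: "(complex \<Rightarrow> complex) \<Rightarrow> complex mat \<Rightarrow> bool" where
  "system_representation f W \<longleftrightarrow>
     (case split_block W 1 1 of (a, b, c, d) \<Rightarrow>
        \<forall>z. let R = 1\<^sub>m (dim_row d) - z \<cdot>\<^sub>m d in
          invertible_mat R \<longrightarrow> f z = (a + z \<cdot>\<^sub>m (b * the (mat_inverse R) * c)) $$ (0, 0))"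

end

theory Submission
  imports Defs
begin

text \<open>
  Write \<open>n = m + 1\<close> and \<open>V\<close> for the matrix with blocks \<open>\<alpha>\<close>, \<open>\<beta>\<close>, \<open>\<gamma>\<close>, \<open>\<delta>\<close>. The first row
  \<open>(s\<^sub>0, b, 0, \<dots>, 0)\<close> of the unitary matrix \<open>U\<close> has norm \<open>1\<close>, so \<open>b\<^sup>2 = 1 - |s\<^sub>0|\<^sup>2\<close>, and it is
  orthogonal to the other rows, so the first column of \<open>D\<^sub>0\<close> is \<open>- cnj s\<^sub>0\<close> times the column
  \<open>C\<^sub>0 / b\<close>, which is also the first column of \<open>V\<close>. Everything except the
  observability half of minimality rests on this proportionality.

  Unitarity: merging the two proportional columns of \<open>[C\<^sub>0 D\<^sub>0]\<close> into the single column \<open>C\<^sub>0 / b\<close>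
  does not change the inner products of the rows, because
  \<open>1 + |s\<^sub>0|\<^sup>2 / b\<^sup>2 = 1 / b\<^sup>2\<close> (\<open>unitary_mat_first_row_structure\<close>).

  Representation: let \<open>y\<close> solve \<open>(I - z \<delta>) y = \<gamma>\<close>, put \<open>\<omega> = \<alpha> + z \<beta> y\<close> and let \<open>u\<close> be the vector
  with blocks \<open>\<omega>\<close> and \<open>y\<close>. Then \<open>(I - z D\<^sub>0) u = (k / b) C\<^sub>0\<close> with \<open>k = 1 + z \<omega> cnj s\<^sub>0\<close>, so
  \<open>u\<close> is a multiple of the state vector \<open>(I - z D\<^sub>0)\<^sup>-\<^sup>1 C\<^sub>0\<close> that computes \<open>s z\<close>. Comparing first
  entries gives \<open>s z - s\<^sub>0 = z \<omega> (1 - s z cnj s\<^sub>0)\<close>, which is the Schur step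
  (\<open>schur_step_value\<close>). This holds for \<open>z \<noteq> 0\<close> with both pencils invertible; the remaining points
  are isolated and are reached by continuity (\<open>system_representation_remove_sings\<close>).

  Minimality: a pair \<open>(\<delta>, \<gamma>)\<close> has a Krylov matrix of full rank iff no nonzero row vector \<open>v\<close>
  annihilates all \<open>\<delta>\<^sup>j \<gamma>\<close> (\<open>det_krylov_mat_nonzero_iff\<close>). If \<open>v\<close> does so, then \<open>(0, v)\<close>
  annihilates all \<open>D\<^sub>0\<^sup>j C\<^sub>0\<close>, since the lower blocks of both \<open>C\<^sub>0\<close> and the first column of
  \<open>D\<^sub>0\<close> are multiples of \<open>\<gamma>\<close>. For the adjoint pair, the corresponding lower blocks are \<open>0\<close> and
  \<open>\<beta>\<^sup>*\<close>, hence multiples of \<open>\<beta>\<^sup>*\<close>, and the same lemma (\<open>krylov_annihilator_compression\<close>)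
  applies.
\<close>

\<comment> \<open>The signs \<open>\<bullet>\<close> and \<open>$\<close> denote the operations on vectors of explicit dimension.\<close>
unbundle no inner_syntax and no vec_syntax and no Formal_Power_Series.fps_syntax

section \<open>Unitary matrices and block decompositions\<close>

lemma mat_adjoint_carrier: "A \<in> carrier_mat r c \<Longrightarrow> mat_adjoint A \<in> carrier_mat c r"
  unfolding mat_adjoint_def by auto

lemma mat_adjoint_index:
  fixes A :: "complex mat"
  assumes "A \<in> carrier_mat r c" "i < c" "j < r"
  shows "mat_adjoint A $$ (i, j) = cnj (A $$ (j, i))"
  using assms unfolding mat_adjoint_def by (auto simp: mat_of_rows_index)

lemma mat_adjoint_four_block_mat:
  fixes a b c d :: "complex mat"
  assumes "a \<in> carrier_mat r1 c1" "b \<in> carrier_mat r1 c2" "c \<in> carrier_mat r2 c1" "d \<in> carrier_mat r2 c2"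
  shows "mat_adjoint (four_block_mat a b c d)
    = four_block_mat (mat_adjoint a) (mat_adjoint c) (mat_adjoint b) (mat_adjoint d)"
proof -
  have W: "four_block_mat a b c d \<in> carrier_mat (r1 + r2) (c1 + c2)"
    using four_block_carrier_mat[OF assms(1,4)] .
  note adj = assms[THEN mat_adjoint_carrier]
  show ?thesis
  proof (rule eq_matI)
    fix i j
    assume "i < dim_row (four_block_mat (mat_adjoint a) (mat_adjoint c) (mat_adjoint b) (mat_adjoint d))"
      and "j < dim_col (four_block_mat (mat_adjoint a) (mat_adjoint c) (mat_adjoint b) (mat_adjoint d))"
    then have ij: "i < c1 + c2" "j < r1 + r2" using adj by auto
    have "four_block_mat (mat_adjoint a) (mat_adjoint c) (mat_adjoint b) (mat_adjoint d) $$ (i, j)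
        = cnj (four_block_mat a b c d $$ (j, i))"
      using ij assms adj by (simp add: mat_adjoint_index[OF assms(1)] mat_adjoint_index[OF assms(2)]
          mat_adjoint_index[OF assms(3)] mat_adjoint_index[OF assms(4)])
    then show "mat_adjoint (four_block_mat a b c d) $$ (i, j)
        = four_block_mat (mat_adjoint a) (mat_adjoint c) (mat_adjoint b) (mat_adjoint d) $$ (i, j)"
      using mat_adjoint_index[OF W ij] by simp
  qed (use mat_adjoint_carrier[OF W] adj in auto)
qed

lemma unitary_mat_iff_rows:
  assumes W: "W \<in> carrier_mat N N"
  shows "unitary_mat W \<longleftrightarrow>
    (\<forall>i<N. \<forall>k<N. (\<Sum>l<N. W $$ (i, l) * cnj (W $$ (k, l))) = (if i = k then 1 else 0))"
proof -
  have A: "mat_adjoint W \<in> carrier_mat N N" by (rule mat_adjoint_carrier[OF W])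
  have "unitary_mat W \<longleftrightarrow> W * mat_adjoint W = 1\<^sub>m N"
    using W A mat_mult_left_right_inverse[OF W A] unfolding unitary_mat_def inverts_mat_def by auto
  also have "\<dots> \<longleftrightarrow> (\<forall>i<N. \<forall>k<N. (W * mat_adjoint W) $$ (i, k) = 1\<^sub>m N $$ (i, k))"
  proof
    assume "\<forall>i<N. \<forall>k<N. (W * mat_adjoint W) $$ (i, k) = 1\<^sub>m N $$ (i, k)"
    then show "W * mat_adjoint W = 1\<^sub>m N" using W A by (intro eq_matI) auto
  qed metis
  also have "\<dots> \<longleftrightarrow> (\<forall>i<N. \<forall>k<N. (\<Sum>l<N. W $$ (i, l) * cnj (W $$ (k, l))) = (if i = k then 1 else 0))"
  proof -
    have "(W * mat_adjoint W) $$ (i, k) = (\<Sum>l<N. W $$ (i, l) * cnj (W $$ (k, l)))"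
      if "i < N" "k < N" for i k
      using that W A by (auto simp: scalar_prod_def mat_adjoint_index[OF W] lessThan_atLeast0 intro!: sum.cong)
    then show ?thesis by auto
  qed
  finally show ?thesis .
qed

lemma split_block_four_block_mat:
  assumes "a \<in> carrier_mat r1 c1" "b \<in> carrier_mat r1 c2" "c \<in> carrier_mat r2 c1" "d \<in> carrier_mat r2 c2"
  shows "split_block (four_block_mat a b c d) r1 c1 = (a, b, c, d)"
  using assms unfolding split_block_def Let_def by (auto intro!: eq_matI)

section \<open>Krylov matrices\<close>

lemma mult_mat_vec_pow_Suc:
  fixes d :: "'a :: comm_ring_1 mat"
  assumes "d \<in> carrier_mat m m" "x \<in> carrier_vec m"
  shows "d ^\<^sub>m Suc k *\<^sub>v x = d *\<^sub>v (d ^\<^sub>m k *\<^sub>v x)"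
  using assms(2)
proof (induction k arbitrary: x)
  case 0
  then show ?case using assms(1) by auto
next
  case (Suc k)
  have P: "d ^\<^sub>m j \<in> carrier_mat m m" for j using assms(1) by (rule pow_carrier_mat)
  have dx: "d *\<^sub>v x \<in> carrier_vec m" using assms(1) Suc.prems by auto
  have e: "d ^\<^sub>m Suc j *\<^sub>v x = d ^\<^sub>m j *\<^sub>v (d *\<^sub>v x)" for j
    using assoc_mult_mat_vec[OF P assms(1) Suc.prems] by simp
  show ?case unfolding e[of "Suc k"] e[of k] using Suc.IH[OF dx] .
qed

lemma mult_mat_vec_pow_add:
  fixes d :: "'a :: comm_ring_1 mat"
  assumes "d \<in> carrier_mat m m" "x \<in> carrier_vec m"
  shows "d ^\<^sub>m (j + k) *\<^sub>v x = d ^\<^sub>m j *\<^sub>v (d ^\<^sub>m k *\<^sub>v x)"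
proof (induction j)
  case 0
  have "d ^\<^sub>m k *\<^sub>v x \<in> carrier_vec m"
    using assms by (metis mult_mat_vec_carrier pow_carrier_mat)
  then show ?case using assms(1) by auto
next
  case (Suc j)
  have y: "d ^\<^sub>m k *\<^sub>v x \<in> carrier_vec m"
    using assms by (metis mult_mat_vec_carrier pow_carrier_mat)
  show ?case
    using Suc mult_mat_vec_pow_Suc[OF assms, of "j + k"] mult_mat_vec_pow_Suc[OF assms(1) y, of j] by simp
qed

lemma krylov_mat_carrier: "krylov_mat m d c \<in> carrier_mat m m"
  by (simp add: krylov_mat_def)

lemma col_krylov_mat:
  assumes "d \<in> carrier_mat m m" "c \<in> carrier_mat m 1" "j < m"
  shows "col (krylov_mat m d c) j = d ^\<^sub>m j *\<^sub>v col c 0"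
  using assms pow_carrier_mat[OF assms(1), of j]
  by (intro eq_vecI) (auto simp: krylov_mat_def)

text \<open>
  The quantification over all powers \<open>j\<close>, instead of \<open>j < m\<close>, is the content of the Cayley-Hamilton
  theorem, but it follows from singularity alone: a linear dependence between the columns \<open>d\<^sup>j c\<close>,
  \<open>j < m\<close>, expresses some \<open>d\<^sup>k c\<close> by lower powers, and shifting it expresses every higher power.
\<close>

lemma det_krylov_mat_nonzero_iff:
  assumes d: "d \<in> carrier_mat m m" and c: "c \<in> carrier_mat m 1"
  shows "det (krylov_mat m d c) \<noteq> 0 \<longleftrightarrow>
    (\<forall>v \<in> carrier_vec m. (\<forall>j. v \<bullet> (d ^\<^sub>m j *\<^sub>v col c 0) = 0) \<longrightarrow> v = 0\<^sub>v m)"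
proof -
  let ?K = "krylov_mat m d c"
  let ?y = "\<lambda>j. d ^\<^sub>m j *\<^sub>v col c 0"
  have K: "?K \<in> carrier_mat m m" by (rule krylov_mat_carrier)
  have cc: "col c 0 \<in> carrier_vec m" using c by (metis carrier_matD(1) col_dim)
  have y: "?y j \<in> carrier_vec m" for j
    using pow_carrier_mat[OF d] cc by (metis mult_mat_vec_carrier)
  have left: "?K\<^sup>T *\<^sub>v v = 0\<^sub>v m \<longleftrightarrow> (\<forall>j<m. v \<bullet> ?y j = 0)" if v: "v \<in> carrier_vec m" for v
  proof -
    have "(?K\<^sup>T *\<^sub>v v) $ j = v \<bullet> ?y j" if "j < m" for j
      using that K v y comm_scalar_prod[OF v y]
      by (simp add: col_krylov_mat[OF d c that])
    moreover have "dim_vec (?K\<^sup>T *\<^sub>v v) = m" using K by simp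
    ultimately show ?thesis by (auto intro!: eq_vecI simp: vec_eq_iff)
  qed
  have singular: "det ?K = 0 \<longleftrightarrow> (\<exists>v \<in> carrier_vec m. v \<noteq> 0\<^sub>v m \<and> (\<forall>j<m. v \<bullet> ?y j = 0))"
    using det_0_iff_vec_prod_zero_field[of "?K\<^sup>T" m] det_transpose[OF K] K left by auto
  have all: "v \<bullet> ?y j = 0"
    if v: "v \<in> carrier_vec m" and low: "\<forall>j<m. v \<bullet> ?y j = 0" and sing: "det ?K = 0" for v j
  proof -
    obtain x where x: "x \<in> carrier_vec m" "x \<noteq> 0\<^sub>v m" and Kx: "?K *\<^sub>v x = 0\<^sub>v m"
      using sing det_0_iff_vec_prod_zero_field[OF K] by blast
    \<comment> \<open>\<open>k\<close> is the highest power that occurs in the dependence with coefficients \<open>x\<close>.\<close>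
    define k where "k = Max {i. i < m \<and> x $ i \<noteq> 0}"
    have "\<exists>i<m. x $ i \<noteq> 0" using x by (metis carrier_vecD eq_vecI index_zero_vec)
    then have ne: "{i. i < m \<and> x $ i \<noteq> 0} \<noteq> {}" by auto
    have k: "k < m" "x $ k \<noteq> 0"
      using Max_in[OF _ ne] unfolding k_def by auto
    have top: "x $ i = 0" if "k < i" "i < m" for i
      using Max_ge[of "{i. i < m \<and> x $ i \<noteq> 0}" i] that unfolding k_def by fastforce
    have dep: "(\<Sum>i<m. x $ i * ?y i $ r) = 0" if "r < m" for r
    proof -
      have "(?K *\<^sub>v x) $ r = 0" using Kx that by simp
      moreover have "?K $$ (r, i) = ?y i $ r" if "i < m" for i
        using col_krylov_mat[OF d c that] K \<open>r < m\<close> that by (metis carrier_matD index_col)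
      ultimately show ?thesis using K x(1) that
        by (simp add: scalar_prod_def lessThan_atLeast0 mult.commute)
    qed
    have dep_shift: "(\<Sum>i<m. x $ i * (v \<bullet> ?y (l + i))) = 0" for l
    proof -
      define P where "P = d ^\<^sub>m l"
      have P: "P \<in> carrier_mat m m" unfolding P_def using d by simp
      have "(\<Sum>i<m. x $ i * (v \<bullet> ?y (l + i))) = (\<Sum>i<m. x $ i * (v \<bullet> (P *\<^sub>v ?y i)))"
        using mult_mat_vec_pow_add[OF d cc] by (simp add: P_def)
      also have "\<dots> = (\<Sum>i<m. \<Sum>q<m. \<Sum>r<m. v $ q * P $$ (q, r) * (x $ i * ?y i $ r))"
        using P v y carrier_vecD[OF y] d
        by (auto intro!: sum.cong simp: scalar_prod_def lessThan_atLeast0 sum_distrib_left algebra_simps)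
      also have "\<dots> = (\<Sum>q<m. \<Sum>i<m. \<Sum>r<m. v $ q * P $$ (q, r) * (x $ i * ?y i $ r))"
        by (rule sum.swap)
      also have "\<dots> = (\<Sum>q<m. \<Sum>r<m. \<Sum>i<m. v $ q * P $$ (q, r) * (x $ i * ?y i $ r))"
        by (intro sum.cong refl sum.swap)
      also have "\<dots> = (\<Sum>q<m. \<Sum>r<m. v $ q * P $$ (q, r) * (\<Sum>i<m. x $ i * ?y i $ r))"
        by (simp add: sum_distrib_left)
      also have "\<dots> = 0" using dep by simp
      finally show ?thesis .
    qed
    show ?thesis
    proof (induction j rule: less_induct)
      case (less j)
      show ?case
      proof (cases "j < m")
        case True
        then show ?thesis using low by blast
      next
        case False
        have "0 = (\<Sum>i<m. x $ i * (v \<bullet> ?y (j - k + i)))" using dep_shift by simp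
        also have "\<dots> = (\<Sum>i<m. if i = k then x $ k * (v \<bullet> ?y j) else 0)"
        proof (intro sum.cong refl)
          fix i assume i: "i \<in> {..<m}"
          consider "i < k" | "i = k" | "k < i" by linarith
          then show "x $ i * (v \<bullet> ?y (j - k + i)) = (if i = k then x $ k * (v \<bullet> ?y j) else 0)"
          proof cases
            case 1
            then have "j - k + i < j" using False k(1) by linarith
            then show ?thesis using less.IH 1 by simp
          next
            case 2
            then show ?thesis using False k(1) by simp
          next
            case 3
            then show ?thesis using top i by simp
          qed
        qed
        also have "\<dots> = x $ k * (v \<bullet> ?y j)" using k(1) by simp
        finally show ?thesis using k(2) by simp
      qed
    qed
  qed
  show ?thesis using singular all by meson
qed

text \<open>
  The conditions on the lower blocks \<open>d21 = p \<gamma>\<close> and \<open>q \<gamma>\<close> cover both halves of minimality. For the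
  pair \<open>(D\<^sub>0, C\<^sub>0)\<close> the scalars are \<open>p = - cnj s\<^sub>0\<close> and \<open>q = b\<close>; for the adjoint pair
  \<open>(D\<^sub>0\<^sup>*, B\<^sub>0\<^sup>*)\<close>, where \<open>\<gamma>\<close> is replaced by \<open>\<beta>\<^sup>*\<close>, they are \<open>p = 1\<close> and \<open>q = 0\<close>.
\<close>

lemma krylov_annihilator_compression:
  fixes D \<delta> :: "complex mat" and \<gamma> :: "complex vec"
  assumes blocks: "d11 \<in> carrier_mat 1 1" "d12 \<in> carrier_mat 1 m" "d21 \<in> carrier_mat m 1" "\<delta> \<in> carrier_mat m m"
    and vecs: "a \<in> carrier_vec 1" "\<gamma> \<in> carrier_vec m"
    and d21: "col d21 0 = p \<cdot>\<^sub>v \<gamma>"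
    and D: "D = four_block_mat d11 d12 d21 \<delta>" and C: "C = a @\<^sub>v (q \<cdot>\<^sub>v \<gamma>)"
    and triv: "\<forall>w \<in> carrier_vec (Suc m). (\<forall>j. w \<bullet> (D ^\<^sub>m j *\<^sub>v C) = 0) \<longrightarrow> w = 0\<^sub>v (Suc m)"
  shows "\<forall>v \<in> carrier_vec m. (\<forall>j. v \<bullet> (\<delta> ^\<^sub>m j *\<^sub>v \<gamma>) = 0) \<longrightarrow> v = 0\<^sub>v m"
proof (intro ballI impI)
  fix v :: "complex vec"
  assume v: "v \<in> carrier_vec m" and ann: "\<forall>j. v \<bullet> (\<delta> ^\<^sub>m j *\<^sub>v \<gamma>) = 0"
  have P: "\<delta> ^\<^sub>m i \<in> carrier_mat m m" for i using blocks(4) by simp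
  have Dc: "D \<in> carrier_mat (Suc m) (Suc m)"
    using four_block_carrier_mat[OF blocks(1,4)] D by simp
  have Cc: "C \<in> carrier_vec (Suc m)" using vecs C by (metis append_carrier_vec plus_1_eq_Suc smult_carrier_vec)
  \<comment> \<open>The lower part of \<open>D\<^sup>j C\<close> lies in the span of the \<open>\<delta>\<^sup>i \<gamma>\<close>. Orthogonality to \<open>v\<close> after every
    power of \<open>\<delta>\<close> is the form of this that is stable under \<open>D\<close>.\<close>
  have bottom: "\<exists>t u. t \<in> carrier_vec 1 \<and> u \<in> carrier_vec m \<and> D ^\<^sub>m j *\<^sub>v C = t @\<^sub>v u \<and>
      (\<forall>i. v \<bullet> (\<delta> ^\<^sub>m i *\<^sub>v u) = 0)" for j
  proof (induction j)
    case 0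
    have "D ^\<^sub>m 0 *\<^sub>v C = a @\<^sub>v (q \<cdot>\<^sub>v \<gamma>)" using Cc Dc C by auto
    moreover have "v \<bullet> (\<delta> ^\<^sub>m i *\<^sub>v (q \<cdot>\<^sub>v \<gamma>)) = 0" for i
      using ann P[of i] vecs(2) v by (simp add: mult_mat_vec[OF P])
    ultimately show ?case using vecs by (intro exI[of _ a] exI[of _ "q \<cdot>\<^sub>v \<gamma>"]) auto
  next
    case (Suc j)
    then obtain t u where t: "t \<in> carrier_vec 1" and u: "u \<in> carrier_vec m"
      and e: "D ^\<^sub>m j *\<^sub>v C = t @\<^sub>v u" and o: "\<And>i. v \<bullet> (\<delta> ^\<^sub>m i *\<^sub>v u) = 0" by blast
    have d21t: "d21 *\<^sub>v t = (p * t $ 0) \<cdot>\<^sub>v \<gamma>"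
    proof (rule eq_vecI)
      fix i assume "i < dim_vec ((p * t $ 0) \<cdot>\<^sub>v \<gamma>)"
      then have i: "i < m" using vecs(2) by simp
      have "d21 $$ (i, 0) = (p \<cdot>\<^sub>v \<gamma>) $ i" using arg_cong[OF d21, of "\<lambda>x. x $ i"] i blocks(3) by simp
      then show "(d21 *\<^sub>v t) $ i = ((p * t $ 0) \<cdot>\<^sub>v \<gamma>) $ i"
        using i blocks(3) t vecs(2) by (simp add: scalar_prod_def)
    qed (use blocks(3) vecs(2) in auto)
    have "D ^\<^sub>m Suc j *\<^sub>v C = (d11 *\<^sub>v t + d12 *\<^sub>v u) @\<^sub>v ((p * t $ 0) \<cdot>\<^sub>v \<gamma> + \<delta> *\<^sub>v u)"
      unfolding mult_mat_vec_pow_Suc[OF Dc Cc] e unfolding D four_block_mat_mult_vec[OF blocks t u] d21t ..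
    moreover have "v \<bullet> (\<delta> ^\<^sub>m i *\<^sub>v ((p * t $ 0) \<cdot>\<^sub>v \<gamma> + \<delta> *\<^sub>v u)) = 0" for i
    proof -
      have du: "\<delta> *\<^sub>v u \<in> carrier_vec m" using blocks(4) u by auto
      have g: "(p * t $ 0) \<cdot>\<^sub>v \<gamma> \<in> carrier_vec m" using vecs(2) by simp
      have "\<delta> ^\<^sub>m i *\<^sub>v ((p * t $ 0) \<cdot>\<^sub>v \<gamma> + \<delta> *\<^sub>v u) = (p * t $ 0) \<cdot>\<^sub>v (\<delta> ^\<^sub>m i *\<^sub>v \<gamma>) + \<delta> ^\<^sub>m Suc i *\<^sub>v u"
        using mult_add_distrib_mat_vec[OF P g du] mult_mat_vec[OF P vecs(2)] assoc_mult_mat_vec[OF P blocks(4) u] by simp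
      moreover have "\<delta> ^\<^sub>m i *\<^sub>v \<gamma> \<in> carrier_vec m" "\<delta> ^\<^sub>m Suc i *\<^sub>v u \<in> carrier_vec m"
        using P[of i] P[of "Suc i"] vecs(2) u by (metis mult_mat_vec_carrier)+
      ultimately show ?thesis using v ann o[of "Suc i"]
        by (simp add: scalar_prod_add_distrib[of _ m] del: pow_mat.simps)
    qed
    moreover have "d11 *\<^sub>v t + d12 *\<^sub>v u \<in> carrier_vec 1" "(p * t $ 0) \<cdot>\<^sub>v \<gamma> + \<delta> *\<^sub>v u \<in> carrier_vec m"
      using blocks vecs t u by auto
    ultimately show ?case by blast
  qed
  define w where "w = 0\<^sub>v 1 @\<^sub>v v"
  have w: "w \<in> carrier_vec (Suc m)" unfolding w_def using v by (metis append_carrier_vec plus_1_eq_Suc zero_carrier_vec)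
  have "w \<bullet> (D ^\<^sub>m j *\<^sub>v C) = 0" for j
  proof -
    obtain t u where t: "t \<in> carrier_vec 1" and u: "u \<in> carrier_vec m"
      and e: "D ^\<^sub>m j *\<^sub>v C = t @\<^sub>v u" and o: "\<And>i. v \<bullet> (\<delta> ^\<^sub>m i *\<^sub>v u) = 0" using bottom by blast
    have "v \<bullet> u = 0" using o[of 0] u blocks(4) by simp
    then show ?thesis unfolding e w_def
      using scalar_prod_append[OF zero_carrier_vec v t u] t by simp
  qed
  then have "w = 0\<^sub>v (Suc m)" using triv w by blast
  moreover have "w $ Suc i = v $ i" if "i < m" for i
    using that v by (simp add: w_def)
  ultimately have "v $ i = 0" if "i < m" for i
    using that by fastforce
  then show "v = 0\<^sub>v m" using v by auto
qed


lemma minimal_colligation_four_block_mat_iff: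
  assumes "a \<in> carrier_mat 1 1" "b \<in> carrier_mat 1 m" "c \<in> carrier_mat m 1" "d \<in> carrier_mat m m"
  shows "minimal_colligation (four_block_mat a b c d) \<longleftrightarrow>
    det (krylov_mat m d c) \<noteq> 0 \<and> det (krylov_mat m (mat_adjoint d) (mat_adjoint b)) \<noteq> 0"
  unfolding minimal_colligation_def split_block_four_block_mat[OF assms] vec_space.det_rank_iff[OF krylov_mat_carrier]
  using assms(4) by simp

section \<open>System representations\<close>

lemma smult_mat_mult_vec:
  fixes A :: "'a :: comm_ring_1 mat"
  assumes "A \<in> carrier_mat r c" "v \<in> carrier_vec c"
  shows "(k \<cdot>\<^sub>m A) *\<^sub>v v = k \<cdot>\<^sub>v (A *\<^sub>v v)"
  using assms by (intro eq_vecI) auto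

lemma pencil_mult_vec:
  fixes D :: "'a :: comm_ring_1 mat"
  assumes D: "D \<in> carrier_mat m m" and v: "v \<in> carrier_vec m"
  shows "(1\<^sub>m m - z \<cdot>\<^sub>m D) *\<^sub>v v = v - z \<cdot>\<^sub>v (D *\<^sub>v v)"
  using minus_mult_distrib_mat_vec[of "1\<^sub>m m" m m "z \<cdot>\<^sub>m D" v] smult_mat_mult_vec[OF assms] assms by simp

lemma ex_solution_of_det_nonzero:
  fixes A :: "'a :: field mat"
  assumes A: "A \<in> carrier_mat n n" and v: "v \<in> carrier_vec n" and "det A \<noteq> 0"
  shows "\<exists>y \<in> carrier_vec n. A *\<^sub>v y = v"
proof (rule bexI)
  have "A *\<^sub>v (adj_mat A *\<^sub>v v) = det A \<cdot>\<^sub>v v"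
    using assoc_mult_mat_vec[OF A adj_mat(1)[OF A] v] adj_mat(2)[OF A]
      smult_mat_mult_vec[OF one_carrier_mat v, of "det A"] v by simp
  then show "A *\<^sub>v ((1 / det A) \<cdot>\<^sub>v (adj_mat A *\<^sub>v v)) = v"
    using assms adj_mat(1)[OF A] mult_mat_vec[OF A, of "adj_mat A *\<^sub>v v" "1 / det A"]
    by (simp add: smult_smult_assoc)
  show "(1 / det A) \<cdot>\<^sub>v (adj_mat A *\<^sub>v v) \<in> carrier_vec n"
    using adj_mat(1)[OF A] v by auto
qed

lemma mat_inverse_of_det_nonzero:
  fixes R :: "'a :: field mat"
  assumes R: "R \<in> carrier_mat m m" and "det R \<noteq> 0"
  obtains S where "mat_inverse R = Some S" "S \<in> carrier_mat m m" "R * S = 1\<^sub>m m" "S * R = 1\<^sub>m m"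
proof (cases "mat_inverse R")
  case None
  from mat_inverse(1)[OF R None, of "()"] det_non_zero_imp_unit[OF R assms(2), of "()"] show ?thesis by blast
next
  case (Some S)
  then show ?thesis using mat_inverse(2)[OF R Some] that by blast
qed

lemma invertible_mat_iff_det_nonzero:
  fixes R :: "'a :: field mat"
  assumes R: "R \<in> carrier_mat m m"
  shows "invertible_mat R \<longleftrightarrow> det R \<noteq> 0"
proof
  assume "invertible_mat R"
  then obtain S where S: "R * S = 1\<^sub>m m" "S * R = 1\<^sub>m (dim_row S)"
    using R unfolding invertible_mat_def inverts_mat_def by auto
  have "dim_col (S * R) = dim_row S" using S(2) by simp
  moreover have "dim_col (R * S) = m" using S(1) by simp
  ultimately have "S \<in> carrier_mat m m" using R by auto
  then have "det R * det S = 1" using det_mult[OF R, of S] S by simp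
  then show "det R \<noteq> 0" by auto
next
  assume "det R \<noteq> 0"
  then show "invertible_mat R"
    using mat_inverse_of_det_nonzero[OF R] R
    unfolding invertible_mat_def inverts_mat_def by (metis carrier_matD square_mat.simps)
qed

text \<open>
  The resolvent is traded for solutions \<open>y\<close> of the linear system \<open>(I - z d) y = c\<close>, which can be
  written down or computed by Cramer's rule.
\<close>

lemma system_representation_four_block_mat_iff:
  assumes "a \<in> carrier_mat 1 1" "b \<in> carrier_mat 1 m" "c \<in> carrier_mat m 1" "d \<in> carrier_mat m m"
  shows "system_representation f (four_block_mat a b c d) \<longleftrightarrow>
    (\<forall>z. \<forall>y \<in> carrier_vec m. det (1\<^sub>m m - z \<cdot>\<^sub>m d) \<noteq> 0 \<longrightarrow> (1\<^sub>m m - z \<cdot>\<^sub>m d) *\<^sub>v y = col c 0 \<longrightarrow>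
       f z = a $$ (0, 0) + z * (row b 0 \<bullet> y))"
proof -
  have "(invertible_mat (1\<^sub>m m - z \<cdot>\<^sub>m d) \<longrightarrow>
      f z = (a + z \<cdot>\<^sub>m (b * the (mat_inverse (1\<^sub>m m - z \<cdot>\<^sub>m d)) * c)) $$ (0, 0)) \<longleftrightarrow>
    (\<forall>y \<in> carrier_vec m. det (1\<^sub>m m - z \<cdot>\<^sub>m d) \<noteq> 0 \<longrightarrow> (1\<^sub>m m - z \<cdot>\<^sub>m d) *\<^sub>v y = col c 0 \<longrightarrow>
       f z = a $$ (0, 0) + z * (row b 0 \<bullet> y))" for z
  proof (cases "det (1\<^sub>m m - z \<cdot>\<^sub>m d) = 0")
    case True
    moreover have "1\<^sub>m m - z \<cdot>\<^sub>m d \<in> carrier_mat m m" using assms(4) by auto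
    ultimately show ?thesis using invertible_mat_iff_det_nonzero by blast
  next
    case False
    define R where "R = 1\<^sub>m m - z \<cdot>\<^sub>m d"
    have R: "R \<in> carrier_mat m m" using assms(4) by (auto simp: R_def)
    have cc: "col c 0 \<in> carrier_vec m" using assms(3) by (metis carrier_matD(1) col_dim)
    obtain S where S: "mat_inverse R = Some S" "S \<in> carrier_mat m m" "R * S = 1\<^sub>m m" "S * R = 1\<^sub>m m"
      using mat_inverse_of_det_nonzero[OF R] False by (auto simp: R_def)
    have sol: "R *\<^sub>v y = col c 0 \<longleftrightarrow> y = S *\<^sub>v col c 0" if y: "y \<in> carrier_vec m" for y
      using assoc_mult_mat_vec[OF S(2) R y] assoc_mult_mat_vec[OF R S(2) cc] S y cc by auto
    have "b * S * c = b * (S * c)" using assms S(2) by (intro assoc_mult_mat) auto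
    moreover have "col (S * c) 0 = S *\<^sub>v col c 0" using assms(3) S(2) by (intro col_mult2) auto
    ultimately have "(a + z \<cdot>\<^sub>m (b * S * c)) $$ (0, 0) = a $$ (0, 0) + z * (row b 0 \<bullet> (S *\<^sub>v col c 0))"
      using assms S(2) by simp
    moreover have "S *\<^sub>v col c 0 \<in> carrier_vec m" using S(2) cc by auto
    moreover have "invertible_mat R" using invertible_mat_iff_det_nonzero[OF R] False R_def by simp
    ultimately show ?thesis using False sol S(1) unfolding R_def[symmetric] by auto
  qed
  then show ?thesis
    using assms(4) unfolding system_representation_def split_block_four_block_mat[OF assms] Let_def by simp
qed

lemma holomorphic_on_det:
  fixes A :: "complex \<Rightarrow> complex mat"
  assumes "\<And>z. A z \<in> carrier_mat n n"
    and "\<And>i j. i < n \<Longrightarrow> j < n \<Longrightarrow> (\<lambda>z. A z $$ (i, j)) holomorphic_on S"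
  shows "(\<lambda>z. det (A z)) holomorphic_on S"
  unfolding det_def'[OF assms(1)]
  by (intro holomorphic_intros assms(2)) (auto simp: permutes_in_image)

lemma holomorphic_on_det_pencil:
  assumes "d \<in> carrier_mat m m"
  shows "(\<lambda>z. det (1\<^sub>m m - z \<cdot>\<^sub>m d)) holomorphic_on S"
  using assms by (intro holomorphic_on_det[where n = m]) (auto intro!: holomorphic_intros)

text \<open>The determinant is holomorphic in \<open>w\<close> and equals \<open>1\<close> at \<open>w = 0\<close>.\<close>

lemma eventually_det_pencil_nonzero:
  fixes z :: complex
  assumes "d \<in> carrier_mat m m"
  shows "\<forall>\<^sub>F w in at z. det (1\<^sub>m m - w \<cdot>\<^sub>m d) \<noteq> 0"
proof -
  have "1\<^sub>m m - 0 \<cdot>\<^sub>m d = 1\<^sub>m m" using assms by (intro eq_matI) auto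
  then have "det (1\<^sub>m m - 0 \<cdot>\<^sub>m d) \<noteq> 0" by simp
  from non_zero_neighbour_alt[where z = z, OF holomorphic_on_det_pencil[OF assms, of UNIV] open_UNIV connected_UNIV UNIV_I UNIV_I this]
  show ?thesis by simp
qed

text \<open>
  A representation that holds in a punctured neighbourhood of every point holds everywhere for the
  function with its removable singularities removed, as its right-hand side is continuous wherever
  the pencil is invertible.
\<close>

lemma system_representation_remove_sings:
  assumes blocks: "a \<in> carrier_mat 1 1" "b \<in> carrier_mat 1 m" "c \<in> carrier_mat m 1" "d \<in> carrier_mat m m"
    and val: "\<And>z. \<forall>\<^sub>F w in at z. \<forall>y \<in> carrier_vec m. (1\<^sub>m m - w \<cdot>\<^sub>m d) *\<^sub>v y = col c 0 \<longrightarrow>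
       f w = a $$ (0, 0) + w * (row b 0 \<bullet> y)"
  shows "system_representation (remove_sings f) (four_block_mat a b c d)"
  unfolding system_representation_four_block_mat_iff[OF blocks]
proof (intro allI ballI impI)
  fix z y
  assume y: "y \<in> carrier_vec m" and det: "det (1\<^sub>m m - z \<cdot>\<^sub>m d) \<noteq> 0"
    and sol: "(1\<^sub>m m - z \<cdot>\<^sub>m d) *\<^sub>v y = col c 0"
  define R where "R = (\<lambda>w. 1\<^sub>m m - w \<cdot>\<^sub>m d)"
  have R: "R w \<in> carrier_mat m m" for w using blocks(4) by (auto simp: R_def)
  have cc: "col c 0 \<in> carrier_vec m" using blocks(3) by (metis carrier_matD(1) col_dim)
  \<comment> \<open>Cramer's rule writes the right-hand side as a function that is continuous in \<open>w\<close>.\<close>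
  define g where "g = (\<lambda>w. a $$ (0, 0) +
    w * (\<Sum>k<m. b $$ (0, k) * (det (replace_col (R w) (col c 0) k) / det (R w))))"
  have g: "a $$ (0, 0) + w * (row b 0 \<bullet> x) = g w"
    if "x \<in> carrier_vec m" "det (R w) \<noteq> 0" "R w *\<^sub>v x = col c 0" for w x
  proof -
    have "x $ k = det (replace_col (R w) (col c 0) k) / det (R w)" if "k < m" for k
      using cramer_lemma_mat[OF R[of w] \<open>x \<in> carrier_vec m\<close> that] \<open>det (R w) \<noteq> 0\<close>
      unfolding \<open>R w *\<^sub>v x = col c 0\<close> by (simp add: field_simps)
    then show ?thesis using that(1) blocks(2)
      by (simp add: g_def scalar_prod_def lessThan_atLeast0)
  qed
  have hol: "(\<lambda>w. det (R w)) holomorphic_on UNIV"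
    unfolding R_def by (rule holomorphic_on_det_pencil[OF blocks(4)])
  have "(\<lambda>w. det (replace_col (R w) (col c 0) k)) holomorphic_on UNIV" for k
  proof (rule holomorphic_on_det[where n = m])
    show "replace_col (R w) (col c 0) k \<in> carrier_mat m m" for w
      using R[of w] by (simp add: replace_col_def)
    fix i j assume ij: "i < m" "j < m"
    show "(\<lambda>w. replace_col (R w) (col c 0) k $$ (i, j)) holomorphic_on UNIV"
      using ij R blocks(4) cc
      by (cases "j = k") (auto simp: replace_col_def R_def intro!: holomorphic_intros)
  qed
  then have num: "isCont (\<lambda>w. det (replace_col (R w) (col c 0) k)) z" for k
    by (meson continuous_on_eq_continuous_at holomorphic_on_imp_continuous_on open_UNIV UNIV_I)
  have den: "isCont (\<lambda>w. det (R w)) z"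
    using hol by (meson continuous_on_eq_continuous_at holomorphic_on_imp_continuous_on open_UNIV UNIV_I)
  have "isCont g z"
    unfolding g_def using det by (intro continuous_intros num den) (auto simp: R_def)
  then have lim: "g \<midarrow>z\<rightarrow> g z" by (simp add: isCont_def)
  have "\<forall>\<^sub>F w in at z. f w = g w"
    using val[of z] eventually_det_pencil_nonzero[OF blocks(4), of z]
  proof eventually_elim
    case (elim w)
    obtain x where "x \<in> carrier_vec m" "R w *\<^sub>v x = col c 0"
      using ex_solution_of_det_nonzero[OF R cc] elim(2) by (auto simp: R_def)
    then show ?case using elim g[of x w] by (simp add: R_def)
  qed
  then have "f \<midarrow>z\<rightarrow> g z" using lim by (simp add: tendsto_cong)
  then show "remove_sings f z = a $$ (0, 0) + z * (row b 0 \<bullet> y)"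
    using g[OF y] det sol by (simp add: R_def remove_sings_eqI)
qed

section \<open>The Schur step\<close>

lemma unitary_mat_first_row_structure:
  assumes C: "C \<in> carrier_mat (Suc m) 1" and D: "D \<in> carrier_mat (Suc m) (Suc m)" and b: "b > 0"
    and U: "unitary_mat (four_block_mat (Matrix.mat 1 1 (\<lambda>_. s0))
      (Matrix.mat 1 (Suc m) (\<lambda>(i, j). if j = 0 then complex_of_real b else 0)) C D)"
  shows "s0 * cnj s0 + (complex_of_real b)\<^sup>2 = 1"
    and "i < Suc m \<Longrightarrow> D $$ (i, 0) = - cnj s0 * (C $$ (i, 0) / b)"
    and "unitary_mat (Matrix.mat (Suc m) (Suc m) (\<lambda>(i, l). if l = 0 then C $$ (i, 0) / b else D $$ (i, l)))"
proof -
  let ?U = "four_block_mat (Matrix.mat 1 1 (\<lambda>_. s0))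
      (Matrix.mat 1 (Suc m) (\<lambda>(i, j). if j = 0 then complex_of_real b else 0)) C D"
  have Uc: "?U \<in> carrier_mat (Suc (Suc m)) (Suc (Suc m))"
    using four_block_carrier_mat[OF _ D, of "Matrix.mat 1 1 (\<lambda>_. s0)" 1 1] by simp
  have rows: "(\<Sum>l<Suc (Suc m). ?U $$ (i, l) * cnj (?U $$ (k, l))) = (if i = k then 1 else 0)"
    if "i < Suc (Suc m)" "k < Suc (Suc m)" for i k
    using U that unfolding unitary_mat_iff_rows[OF Uc] by blast
  show norm: "s0 * cnj s0 + (complex_of_real b)\<^sup>2 = 1"
    using rows[of 0 0] C D by (simp add: sum.lessThan_Suc_shift power2_eq_square del: sum.lessThan_Suc)
  have "C $$ (i, 0) * cnj s0 + D $$ (i, 0) * b = 0" if "i < Suc m" for i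
    using rows[of "Suc i" 0] C D that by (simp add: sum.lessThan_Suc_shift del: sum.lessThan_Suc)
  then show D0: "D $$ (i, 0) = - cnj s0 * (C $$ (i, 0) / b)" if "i < Suc m" for i
    using b that by (simp add: field_simps add_eq_0_iff)
  have inner: "C $$ (i, 0) / b * cnj (C $$ (k, 0) / b) + (\<Sum>l<m. D $$ (i, Suc l) * cnj (D $$ (k, Suc l)))
      = (if i = k then 1 else 0)" if "i < Suc m" "k < Suc m" for i k
  proof -
    have "C $$ (i, 0) * cnj (C $$ (k, 0)) + D $$ (i, 0) * cnj (D $$ (k, 0))
        + (\<Sum>l<m. D $$ (i, Suc l) * cnj (D $$ (k, Suc l))) = (if i = k then 1 else 0)"
      using rows[of "Suc i" "Suc k"] C D that
      by (simp add: sum.lessThan_Suc_shift add.assoc del: sum.lessThan_Suc)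
    moreover have "C $$ (i, 0) * cnj (C $$ (k, 0)) + D $$ (i, 0) * cnj (D $$ (k, 0))
        = (s0 * cnj s0 + (complex_of_real b)\<^sup>2) * (C $$ (i, 0) / b * cnj (C $$ (k, 0) / b))"
      using b that by (simp add: D0 field_simps power2_eq_square)
    ultimately show ?thesis using norm by simp
  qed
  show "unitary_mat (Matrix.mat (Suc m) (Suc m) (\<lambda>(i, l). if l = 0 then C $$ (i, 0) / b else D $$ (i, l)))"
    using inner by (subst unitary_mat_iff_rows[where N = "Suc m"])
      (simp_all add: sum.lessThan_Suc_shift del: sum.lessThan_Suc)
qed

text \<open>
  The number \<open>sz\<close> is the value of the given system at \<open>z\<close> and \<open>\<omega>\<close> is the value of the compressed
  one, where \<open>y\<close> solves the linear system of the compressed pencil.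
\<close>

lemma schur_step_value:
  fixes z s0 sz \<omega> b :: complex
  assumes C: "C \<in> carrier_mat (Suc m) 1" and D: "D \<in> carrier_mat (Suc m) (Suc m)" and b: "b \<noteq> 0"
    and norm: "s0 * cnj s0 + b\<^sup>2 = 1"
    and D0: "\<And>i. i < Suc m \<Longrightarrow> D $$ (i, 0) = - cnj s0 * (C $$ (i, 0) / b)"
    and z: "z \<noteq> 0" and det: "det (1\<^sub>m (Suc m) - z \<cdot>\<^sub>m D) \<noteq> 0"
    and sz: "\<And>x. x \<in> carrier_vec (Suc m) \<Longrightarrow> (1\<^sub>m (Suc m) - z \<cdot>\<^sub>m D) *\<^sub>v x = col C 0 \<Longrightarrow> sz = s0 + z * (b * x $ 0)"
    and y: "\<And>i. i < m \<Longrightarrow> y i - z * (\<Sum>l<m. D $$ (Suc i, Suc l) * y l) = C $$ (Suc i, 0) / b"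
    and \<omega>: "\<omega> = C $$ (0, 0) / b + z * (\<Sum>l<m. D $$ (0, Suc l) * y l)"
  shows "1 / z * ((sz - s0) / (1 - sz * cnj s0)) = \<omega>"
proof -
  let ?R = "1\<^sub>m (Suc m) - z \<cdot>\<^sub>m D"
  have R: "?R \<in> carrier_mat (Suc m) (Suc m)" using D by auto
  define k where "k = 1 + z * cnj s0 * \<omega>"
  define u where "u = Matrix.vec (Suc m) (\<lambda>i. case i of 0 \<Rightarrow> \<omega> | Suc l \<Rightarrow> y l)"
  have u: "u \<in> carrier_vec (Suc m)" by (simp add: u_def)
  have Ru: "?R *\<^sub>v u = (k / b) \<cdot>\<^sub>v col C 0"
  proof (rule eq_vecI)
    fix i assume "i < dim_vec ((k / b) \<cdot>\<^sub>v col C 0)"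
    then have i: "i < Suc m" using C by simp
    have "(?R *\<^sub>v u) $ i = (u - z \<cdot>\<^sub>v (D *\<^sub>v u)) $ i"
      by (simp only: pencil_mult_vec[OF D u])
    also have "\<dots> = u $ i - z * (D $$ (i, 0) * \<omega> + (\<Sum>l<m. D $$ (i, Suc l) * y l))"
      using i D by (simp add: u_def scalar_prod_def lessThan_atLeast0[symmetric]
          sum.lessThan_Suc_shift del: sum.lessThan_Suc)
    also have "\<dots> = (u $ i - z * (\<Sum>l<m. D $$ (i, Suc l) * y l)) + z * cnj s0 * \<omega> * (C $$ (i, 0) / b)"
      unfolding D0[OF i] by (simp add: algebra_simps)
    also have "u $ i - z * (\<Sum>l<m. D $$ (i, Suc l) * y l) = C $$ (i, 0) / b"
      using i y \<omega> by (cases i) (simp_all add: u_def)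
    also have "C $$ (i, 0) / b + z * cnj s0 * \<omega> * (C $$ (i, 0) / b) = k / b * C $$ (i, 0)"
      by (simp add: k_def algebra_simps add_divide_distrib)
    finally show "(?R *\<^sub>v u) $ i = ((k / b) \<cdot>\<^sub>v col C 0) $ i" using i C by simp
  qed (use C D in auto)
  \<comment> \<open>If \<open>k = 0\<close>, then \<open>u\<close> is in the kernel of the invertible pencil, so \<open>\<omega> = 0\<close> and \<open>k = 1\<close>.\<close>
  have "k \<noteq> 0"
  proof
    assume k: "k = 0"
    then have "?R *\<^sub>v u = 0\<^sub>v (Suc m)" using Ru C by (auto intro!: eq_vecI)
    then have "u = 0\<^sub>v (Suc m)" using det det_0_iff_vec_prod_zero_field[OF R] u by blast
    then have "\<omega> = 0" by (metis index_vec index_zero_vec(1) nat.case(1) u_def zero_less_Suc)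
    then show False using k by (simp add: k_def)
  qed
  have "?R *\<^sub>v ((b / k) \<cdot>\<^sub>v u) = col C 0"
    using mult_mat_vec[OF R u, of "b / k"] \<open>k \<noteq> 0\<close> b by (simp add: Ru smult_smult_assoc)
  then have "sz = s0 + z * (b * ((b / k) \<cdot>\<^sub>v u) $ 0)" using u by (intro sz) auto
  then have s: "k * (sz - s0) = z * b\<^sup>2 * \<omega>"
    using \<open>k \<noteq> 0\<close> by (simp add: u_def power2_eq_square)
  have b2: "b\<^sup>2 = 1 - s0 * cnj s0" using norm by (simp add: algebra_simps)
  have key: "sz - s0 = z * \<omega> * (1 - sz * cnj s0)"
    using s unfolding b2 k_def by (simp add: algebra_simps)
  have "1 - sz * cnj s0 \<noteq> 0"
  proof
    assume 0: "1 - sz * cnj s0 = 0"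
    then have "sz = s0" using key by simp
    then have "b\<^sup>2 = 0" using b2 0 by simp
    then show False using b by simp
  qed
  then show ?thesis using key z by (simp add: field_simps)
qed

section \<open>The Schur transform of a rational inner function\<close>

theorem theorem7p2:
  fixes s :: "complex \<Rightarrow> complex" and n :: nat and s0 :: complex and b :: real
    and U B0 C0 D0 c1 c2 d11 d12 d21 d22 \<alpha> \<beta> \<gamma> \<delta> :: "complex mat"
  assumes "n > 1"
    and "rational_inner s" and "rational_of_degree s n"
    and "s0 = s 0"
    and "B0 \<in> carrier_mat 1 n" and "C0 \<in> carrier_mat n 1" and "D0 \<in> carrier_mat n n"
    and "U = four_block_mat (Matrix.mat 1 1 (\<lambda>_. s0)) B0 C0 D0"
    and "unitary_mat U"
    and "system_representation s U"
    and "minimal_colligation U"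
    and "b > 0"
    and "B0 = Matrix.mat 1 n (\<lambda>(i, j). if j = 0 then complex_of_real b else 0)"
    and "c1 \<in> carrier_mat 1 1" and "c2 \<in> carrier_mat (n - 1) 1"
    and "C0 = c1 @\<^sub>r c2"
    and "d11 \<in> carrier_mat 1 1" and "d12 \<in> carrier_mat 1 (n - 1)"
    and "d21 \<in> carrier_mat (n - 1) 1" and "d22 \<in> carrier_mat (n - 1) (n - 1)"
    and "D0 = four_block_mat d11 d12 d21 d22"
    and "\<alpha> = complex_of_real ((1 - (cmod s0)\<^sup>2) powr (-1/2)) \<cdot>\<^sub>m c1"
    and "\<beta> = d12"
    and "\<gamma> = complex_of_real ((1 - (cmod s0)\<^sup>2) powr (-1/2)) \<cdot>\<^sub>m c2"
    and "\<delta> = d22"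
  shows "unitary_mat (four_block_mat \<alpha> \<beta> \<gamma> \<delta>)
    \<and> system_representation (schur_transform s) (four_block_mat \<alpha> \<beta> \<gamma> \<delta>)
    \<and> minimal_colligation (four_block_mat \<alpha> \<beta> \<gamma> \<delta>)"
proof -
  obtain m where n: "n = Suc m" using \<open>n > 1\<close> by (cases n) auto
  note dims = assms(5-7)[unfolded n] assms(14,15,17-20)[unfolded n diff_Suc_1]
  note B0 = assms(13)[unfolded n]
  note U = assms(8)
  have C: "C0 \<in> carrier_mat (Suc m) 1" and D: "D0 \<in> carrier_mat (Suc m) (Suc m)" by (fact dims)+
  note first_row = unitary_mat_first_row_structure[OF C D \<open>b > 0\<close> assms(9)[unfolded U B0]]
  have "(cmod s0)\<^sup>2 + b\<^sup>2 = 1"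
    using first_row(1) by (metis complex_norm_square of_real_1 of_real_add of_real_eq_iff of_real_power)
  then have "1 - (cmod s0)\<^sup>2 = b\<^sup>2" by simp
  then have scale: "complex_of_real ((1 - (cmod s0)\<^sup>2) powr (-1/2)) = 1 / b"
    using \<open>b > 0\<close> by (simp add: powr_minus powr_half_sqrt powr_divide inverse_eq_divide)
  have \<alpha>: "\<alpha> \<in> carrier_mat 1 1" and \<beta>: "\<beta> \<in> carrier_mat 1 m" and \<gamma>: "\<gamma> \<in> carrier_mat m 1" and \<delta>: "\<delta> \<in> carrier_mat m m"
    using dims assms(22-25) by auto
  have \<alpha>_entry: "\<alpha> $$ (0, 0) = C0 $$ (0, 0) / b"
    using dims assms(16,22) scale by (simp add: append_rows_def)
  have \<gamma>_entry: "\<gamma> $$ (i, 0) = C0 $$ (Suc i, 0) / b" if "i < m" for i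
    using that dims assms(16,24) scale by (simp add: append_rows_def)
  have \<beta>_entry: "\<beta> $$ (0, l) = D0 $$ (0, Suc l)" if "l < m" for l
    using that dims assms(21,23) by simp
  have \<delta>_entry: "\<delta> $$ (i, l) = D0 $$ (Suc i, Suc l)" if "i < m" "l < m" for i l
    using that dims assms(21,25) by simp
  let ?V = "Matrix.mat (Suc m) (Suc m) (\<lambda>(i, l). if l = 0 then C0 $$ (i, 0) / b else D0 $$ (i, l))"
  have "four_block_mat \<alpha> \<beta> \<gamma> \<delta> = ?V"
  proof (rule eq_matI)
    fix i l
    assume "i < dim_row ?V" and "l < dim_col ?V"
    then show "four_block_mat \<alpha> \<beta> \<gamma> \<delta> $$ (i, l) = ?V $$ (i, l)"
      using \<alpha> \<beta> \<gamma> \<delta> \<alpha>_entry \<beta>_entry \<gamma>_entry \<delta>_entry by (cases i; cases l) auto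
  qed (use \<alpha> \<delta> in auto)
  then have unitary: "unitary_mat (four_block_mat \<alpha> \<beta> \<gamma> \<delta>)"
    using first_row(3) by simp
  have s: "s z = s0 + z * (b * x $ 0)"
    if "det (1\<^sub>m (Suc m) - z \<cdot>\<^sub>m D0) \<noteq> 0" "x \<in> carrier_vec (Suc m)" "(1\<^sub>m (Suc m) - z \<cdot>\<^sub>m D0) *\<^sub>v x = col C0 0" for z x
  proof -
    have "row B0 0 \<bullet> x = b * x $ 0"
      using that(2) by (simp add: B0 scalar_prod_def sum.atLeast0_lessThan_Suc_shift del: sum.op_ivl_Suc)
    then show ?thesis
      using assms(10)[unfolded U system_representation_four_block_mat_iff[OF mat_carrier dims(1-3)]] that
      by simp
  qed
  have schur_value: "\<forall>\<^sub>F w in at z. \<forall>y \<in> carrier_vec m. (1\<^sub>m m - w \<cdot>\<^sub>m \<delta>) *\<^sub>v y = col \<gamma> 0 \<longrightarrow>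
      1 / w * ((s w - s 0) / (1 - s w * cnj (s 0))) = \<alpha> $$ (0, 0) + w * (row \<beta> 0 \<bullet> y)" for z
  proof -
    have "\<forall>\<^sub>F w in at z. w \<noteq> 0"
      by (rule eventually_neq_at_within)
    then show ?thesis using eventually_det_pencil_nonzero[OF D, of z]
    proof eventually_elim
      case (elim w)
      show ?case
      proof (intro ballI impI)
        fix y assume y: "y \<in> carrier_vec m" and sol: "(1\<^sub>m m - w \<cdot>\<^sub>m \<delta>) *\<^sub>v y = col \<gamma> 0"
        have "y $ i - w * (\<Sum>l<m. D0 $$ (Suc i, Suc l) * y $ l) = C0 $$ (Suc i, 0) / b" if "i < m" for i
        proof -
          have "(1\<^sub>m m - w \<cdot>\<^sub>m \<delta>) *\<^sub>v y = y - w \<cdot>\<^sub>v (\<delta> *\<^sub>v y)"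
            by (rule pencil_mult_vec[OF \<delta> y])
          then have "(y - w \<cdot>\<^sub>v (\<delta> *\<^sub>v y)) $ i = col \<gamma> 0 $ i" using sol by simp
          then have "(y - w \<cdot>\<^sub>v (\<delta> *\<^sub>v y)) $ i = \<gamma> $$ (i, 0)" using \<gamma> that by simp
          then show ?thesis
            using that y \<delta> by (simp add: \<gamma>_entry \<delta>_entry scalar_prod_def lessThan_atLeast0)
        qed
        moreover have "\<alpha> $$ (0, 0) + w * (row \<beta> 0 \<bullet> y) = C0 $$ (0, 0) / b + w * (\<Sum>l<m. D0 $$ (0, Suc l) * y $ l)"
          using \<beta> y by (simp add: \<alpha>_entry \<beta>_entry scalar_prod_def lessThan_atLeast0)
        ultimately show "1 / w * ((s w - s 0) / (1 - s w * cnj (s 0))) = \<alpha> $$ (0, 0) + w * (row \<beta> 0 \<bullet> y)"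
          unfolding \<open>s0 = s 0\<close>[symmetric]
          using \<open>b > 0\<close> elim s
          by (intro schur_step_value[OF C D _ first_row(1,2)]) auto
      qed
    qed
  qed
  have representation: "system_representation (schur_transform s) (four_block_mat \<alpha> \<beta> \<gamma> \<delta>)"
    unfolding schur_transform_def
    by (rule system_representation_remove_sings[OF \<alpha> \<beta> \<gamma> \<delta> schur_value])
  have minimalU: "det (krylov_mat (Suc m) D0 C0) \<noteq> 0"
      "det (krylov_mat (Suc m) (mat_adjoint D0) (mat_adjoint B0)) \<noteq> 0"
    using assms(11) unfolding U minimal_colligation_four_block_mat_iff[OF mat_carrier dims(1-3)] by auto
  have c1: "col c1 0 \<in> carrier_vec 1" using dims by (metis carrier_matD(1) col_dim)
  have "col \<gamma> 0 \<in> carrier_vec m" using \<gamma> by (metis carrier_matD(1) col_dim)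
  moreover have "col d21 0 = (- cnj s0) \<cdot>\<^sub>v col \<gamma> 0"
  proof (rule eq_vecI)
    fix i assume "i < dim_vec ((- cnj s0) \<cdot>\<^sub>v col \<gamma> 0)"
    then have i: "i < m" using \<gamma> by simp
    have "D0 $$ (Suc i, 0) = d21 $$ (i, 0)" using i dims assms(21) by simp
    then show "col d21 0 $ i = ((- cnj s0) \<cdot>\<^sub>v col \<gamma> 0) $ i"
      using first_row(2)[of "Suc i"] i dims \<gamma> by (simp add: \<gamma>_entry)
  qed (use dims \<gamma> in auto)
  moreover have "col C0 0 = col c1 0 @\<^sub>v (complex_of_real b \<cdot>\<^sub>v col \<gamma> 0)"
  proof (rule eq_vecI)
    fix i assume "i < dim_vec (col c1 0 @\<^sub>v (complex_of_real b \<cdot>\<^sub>v col \<gamma> 0))"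
    then have i: "i < Suc m" using dims \<gamma> by simp
    then show "col C0 0 $ i = (col c1 0 @\<^sub>v (complex_of_real b \<cdot>\<^sub>v col \<gamma> 0)) $ i"
      using \<open>b > 0\<close> dims \<gamma> \<alpha>_entry assms(22) scale by (cases i) (simp_all add: \<gamma>_entry)
  qed (use dims \<gamma> in auto)
  ultimately have controllable: "det (krylov_mat m \<delta> \<gamma>) \<noteq> 0"
    unfolding det_krylov_mat_nonzero_iff[OF \<delta> \<gamma>]
    using minimalU(1) unfolding det_krylov_mat_nonzero_iff[OF D C]
    using krylov_annihilator_compression[OF dims(6,7,8) \<delta> c1, of "col \<gamma> 0" "- cnj s0" D0 "col C0 0" b] assms(21,25)
    by blast
  have adj: "mat_adjoint d11 \<in> carrier_mat 1 1" "mat_adjoint d21 \<in> carrier_mat 1 m"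
      "mat_adjoint d12 \<in> carrier_mat m 1" "mat_adjoint \<delta> \<in> carrier_mat m m" "mat_adjoint \<beta> \<in> carrier_mat m 1"
      "mat_adjoint D0 \<in> carrier_mat (Suc m) (Suc m)" "mat_adjoint B0 \<in> carrier_mat (Suc m) 1"
    using dims \<beta> \<delta> by (auto intro: mat_adjoint_carrier)
  have "col (mat_adjoint \<beta>) 0 \<in> carrier_vec m" using adj by (metis carrier_matD(1) col_dim)
  moreover have "col (mat_adjoint d12) 0 = 1 \<cdot>\<^sub>v col (mat_adjoint \<beta>) 0" using assms(23) by simp
  moreover have "mat_adjoint D0 = four_block_mat (mat_adjoint d11) (mat_adjoint d21) (mat_adjoint d12) (mat_adjoint \<delta>)"
    unfolding assms(21,25) by (rule mat_adjoint_four_block_mat[OF dims(6-9)])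
  moreover have "col (mat_adjoint B0) 0 = Matrix.vec 1 (\<lambda>_. complex_of_real b) @\<^sub>v (0 \<cdot>\<^sub>v col (mat_adjoint \<beta>) 0)"
  proof (rule eq_vecI)
    fix i assume "i < dim_vec (Matrix.vec 1 (\<lambda>_. complex_of_real b) @\<^sub>v (0 \<cdot>\<^sub>v col (mat_adjoint \<beta>) 0))"
    then have i: "i < Suc m" using adj by simp
    have "B0 $$ (0, i) = (if i = 0 then complex_of_real b else 0)" unfolding B0 using i by simp
    then have entry: "mat_adjoint B0 $$ (i, 0) = (if i = 0 then complex_of_real b else 0)"
      using mat_adjoint_index[OF dims(1) i, of 0] by simp
    from i show "col (mat_adjoint B0) 0 $ i = (Matrix.vec 1 (\<lambda>_. complex_of_real b) @\<^sub>v (0 \<cdot>\<^sub>v col (mat_adjoint \<beta>) 0)) $ i"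
      using adj entry by (cases i) simp_all
  qed (use adj in auto)
  ultimately have observable: "det (krylov_mat m (mat_adjoint \<delta>) (mat_adjoint \<beta>)) \<noteq> 0"
    unfolding det_krylov_mat_nonzero_iff[OF adj(4,5)]
    using minimalU(2) unfolding det_krylov_mat_nonzero_iff[OF adj(6,7)]
    using krylov_annihilator_compression[OF adj(1-4), of "Matrix.vec 1 (\<lambda>_. complex_of_real b)"
        "col (mat_adjoint \<beta>) 0" 1 "mat_adjoint D0" "col (mat_adjoint B0) 0" 0]
    by simp
  show ?thesis
    using unitary representation controllable observable
      minimal_colligation_four_block_mat_iff[OF \<alpha> \<beta> \<gamma> \<delta>] by blast
qed

end
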